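(* Let $a:AF_g\to\mathbb{R}$ be a functional on the set $AF_g$ of grafted forests and let $$S(a)=\sum_{\pi\in AF_g}\frac{a(\pi)}{\sigma(\pi)}F_f(\pi)$$ be the corresponding S-series over grafted forests. For $b:EF\to\mathbb{R}$ defined on the set $EF$ of exotic forests, let $ES(b)=\sum_{\pi\in EF}\frac{b(\pi)}{\sigma(\pi)}F_f(\pi)$ be the exotic S-series. Let $\Phi:EF\to AF_g$ be the map that forgets the pairing of the grafted vertices. Then the expectation of $S(a)$ is an exotic S-series, namely $$\mathbb{E}[S(a)]=ES(a\circ\Phi).$$
   Context: **Forests.** An aromatic forest is a finite directed graph (self-loops allowed) in which every vertex has at most one outgoing edge, and which is either empty or has at least one root (vertex without outgoing edge). A grafted forest is an aromatic forest with vertices coloured $\bullet$ (black) or $\times$ (grafted), grafted vertices having no incoming edges; $AF_g$ is the set of their isomorphism classes. An exotic forest is a grafted forest together with a perfect matching of its grafted vertices (a matched pair is called a liana), up to isomorphisms preserving colours and matching; $EF$ is the set of exotic forests. In both cases $\sigma(\pi)$ is the number of automorphisms of $\pi$ (preserving all the structure). **Differential operators.** Let $f:\mathbb{R}^d\to\mathbb{R}^d$ be a smooth vector field, $h$ the timestep, $\xi\sim\mathcal{N}(0,I_d)$ a standard Gaussian vector. Let $p(v)$ denote the set of predecessors of a vertex $v$ (vertices with an edge to $v$). For a grafted forest $\pi$ and a smooth function $\phi$, $$F_f(\pi)[\phi]=\sum_{i:V(\pi)\to\{1,\dots,d\}}\ \prod_{v\in V(\pi)}\Big(\prod_{u\in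 p(v)}\partial_{i(u)}\Big)F_f(v)^{i(v)}\ \cdot\Big(\prod_{r\text{ root}}\partial_{i(r)}\Big)\phi,$$ with $F_f(v)=hf$ for black $v$ and $F_f(v)=\sqrt{2h}\,\xi$ (constant in space) for grafted $v$. For an exotic forest, $F_f(\pi)[\phi]$ is given by the same formula with $F_f(v)^{i(v)}=\sqrt{2h}$ for grafted $v$ and with the sum restricted to those $i$ with $i(v_1)=i(v_2)$ for every liana $\{v_1,v_2\}$. Series are formal, and the expectation $\mathbb{E}$ (over $\xi$) is taken term by term. *)

theory Defs
  imports "HOL-Probability.Probability"
begin

section \<open>Forests\<close>

text \<open>Up to isomorphism, the vertices of a finite graph may be taken in \<^typ>\<open>nat\<close>. An edge set is
  enough (no multigraph is needed) because every vertex has at most one outgoing edge.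
  The vertices outside \<open>grafts\<close> are the black ones.\<close>

record gforest =
  verts :: "nat set"
  edges :: "(nat \<times> nat) set"
  grafts :: "nat set"

record eforest = gforest +
  lianas :: "nat set set"

definition black :: "'z gforest_scheme \<Rightarrow> nat set" where
  "black G = verts G - grafts G"

definition roots :: "'z gforest_scheme \<Rightarrow> nat set" where
  "roots G = {v \<in> verts G. v \<notin> Domain (edges G)}"

definition preds :: "'z gforest_scheme \<Rightarrow> nat \<Rightarrow> nat set" where
  "preds G v = {u. (u, v) \<in> edges G}"

definition aromatic_forest :: "'z gforest_scheme \<Rightarrow> bool" where
  "aromatic_forest G \<longleftrightarrow>
     finite (verts G) \<and> edges G \<subseteq> verts G \<times> verts G \<and> single_valued (edges G) \<and>
     (verts G = {} \<or> roots G \<noteq> {})"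

definition grafted_forest :: "'z gforest_scheme \<Rightarrow> bool" where
  "grafted_forest G \<longleftrightarrow>
     aromatic_forest G \<and> grafts G \<subseteq> verts G \<and> (\<forall>v\<in>grafts G. preds G v = {})"

definition exotic_forest :: "eforest \<Rightarrow> bool" where
  "exotic_forest G \<longleftrightarrow>
     grafted_forest G \<and> partition_on (grafts G) (lianas G) \<and> (\<forall>l\<in>lianas G. card l = 2)"

definition grafted_isomorphism ::
    "(nat \<Rightarrow> nat) \<Rightarrow> 'z gforest_scheme \<Rightarrow> 'z gforest_scheme \<Rightarrow> bool" where
  "grafted_isomorphism p G H \<longleftrightarrow>
     bij_betw p (verts G) (verts H) \<and> edges H = map_prod p p ` edges G \<and> grafts H = p ` grafts G"

definition exotic_isomorphism :: "(nat \<Rightarrow> nat) \<Rightarrow> eforest \<Rightarrow> eforest \<Rightarrow> bool" where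
  "exotic_isomorphism p G H \<longleftrightarrow>
     grafted_isomorphism p G H \<and> lianas H = (\<lambda>l. p ` l) ` lianas G"

definition grafted_iso :: "gforest rel" where
  "grafted_iso = {(G, H). grafted_forest G \<and> grafted_forest H \<and> (\<exists>p. grafted_isomorphism p G H)}"

definition exotic_iso :: "eforest rel" where
  "exotic_iso = {(G, H). exotic_forest G \<and> exotic_forest H \<and> (\<exists>p. exotic_isomorphism p G H)}"

definition AFg :: "gforest set set" where
  "AFg = {G. grafted_forest G} // grafted_iso"

definition EF :: "eforest set set" where
  "EF = {G. exotic_forest G} // exotic_iso"

definition forget :: "eforest set \<Rightarrow> gforest set" ("\<Phi>") where
  "forget \<pi> = grafted_iso `` (gforest.truncate ` \<pi>)"

text \<open>Symmetry coefficients and differential operators are defined on graphs and evaluated on an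
  isomorphism class through a representative; they do not depend on its choice.\<close>

definition rep :: "'g set \<Rightarrow> 'g" where
  "rep \<pi> = (SOME G. G \<in> \<pi>)"

text \<open>Each automorphism is counted once, as a permutation of \<^typ>\<open>nat\<close> that is the identity off
  the vertex set.\<close>

definition sigma_g :: "gforest set \<Rightarrow> nat" where
  "sigma_g \<pi> = card {p. p permutes verts (rep \<pi>) \<and> grafted_isomorphism p (rep \<pi>) (rep \<pi>)}"

definition sigma_e :: "eforest set \<Rightarrow> nat" where
  "sigma_e \<pi> = card {p. p permutes verts (rep \<pi>) \<and> exotic_isomorphism p (rep \<pi>) (rep \<pi>)}"

section \<open>Differential operators\<close>

definition partial :: "'d \<Rightarrow> ((real^'d::finite) \<Rightarrow> real) \<Rightarrow> (real^'d) \<Rightarrow> real" where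
  "partial j g x = deriv (\<lambda>t. g (x + t *\<^sub>R axis j 1)) 0"

definition smooth :: "((real^'d::finite) \<Rightarrow> real) \<Rightarrow> bool" where
  "smooth g \<longleftrightarrow> (\<forall>js. continuous_on UNIV (foldr partial js g) \<and>
     (\<forall>j x. (\<lambda>t. foldr partial js g (x + t *\<^sub>R axis j 1)) differentiable at 0))"

definition smooth_field :: "((real^'d::finite) \<Rightarrow> real^'d) \<Rightarrow> bool" where
  "smooth_field f \<longleftrightarrow> (\<forall>j. smooth (\<lambda>x. f x $ j))"

text \<open>\<open>partials i U\<close> is the product over \<open>u \<in> U\<close> of the operators \<open>partial (i u)\<close>, composed in some
  order; for smooth functions the order is immaterial by symmetry of mixed derivatives.\<close>

definition partials ::
    "(nat \<Rightarrow> 'd) \<Rightarrow> nat set \<Rightarrow> ((real^'d::finite) \<Rightarrow> real) \<Rightarrow> (real^'d) \<Rightarrow> real" where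
  "partials i U g = foldr partial (SOME js. mset js = image_mset i (mset_set U)) g"

text \<open>\<open>K v\<close> is the vector field attached to the vertex \<open>v\<close>, and \<open>I\<close> the set of admissible index
  maps.\<close>

definition elem_diff ::
    "(nat \<Rightarrow> (real^'d::finite) \<Rightarrow> real^'d) \<Rightarrow> (nat \<Rightarrow> 'd) set \<Rightarrow> 'z gforest_scheme \<Rightarrow>
     ((real^'d) \<Rightarrow> real) \<Rightarrow> (real^'d) \<Rightarrow> real" where
  "elem_diff K I G \<phi> x =
     (\<Sum>i\<in>I. (\<Prod>v\<in>verts G. partials i (preds G v) (\<lambda>y. K v y $ i v) x) * partials i (roots G) \<phi> x)"

definition F_grafted ::
    "real \<Rightarrow> ((real^'d::finite) \<Rightarrow> real^'d) \<Rightarrow> real^'d \<Rightarrow> gforest set \<Rightarrow>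
     ((real^'d) \<Rightarrow> real) \<Rightarrow> (real^'d) \<Rightarrow> real" where
  "F_grafted h f \<xi> \<pi> =
     (let G = rep \<pi> in
      elem_diff (\<lambda>v y. if v \<in> grafts G then sqrt (2 * h) *\<^sub>R \<xi> else h *\<^sub>R f y)
        (verts G \<rightarrow>\<^sub>E UNIV) G)"

definition F_exotic ::
    "real \<Rightarrow> ((real^'d::finite) \<Rightarrow> real^'d) \<Rightarrow> eforest set \<Rightarrow>
     ((real^'d) \<Rightarrow> real) \<Rightarrow> (real^'d) \<Rightarrow> real" where
  "F_exotic h f \<pi> =
     (let G = rep \<pi> in
      elem_diff (\<lambda>v y. if v \<in> grafts G then (\<chi> j. sqrt (2 * h)) else h *\<^sub>R f y)
        {i \<in> verts G \<rightarrow>\<^sub>E UNIV. \<forall>l\<in>lianas G. \<forall>u\<in>l. \<forall>v\<in>l. i u = i v} G)"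

section \<open>Formal series\<close>

text \<open>Black vertices contribute a factor \<open>h\<close> and grafted ones a factor \<open>sqrt h\<close>, so the operator of
  a forest carries \<open>h\<close> to the power \<open>half_order / 2\<close>. The formal series are power series in
  \<open>sqrt h\<close>, represented by the sequence of their homogeneous components: the \<open>n\<close>-th component
  is the (finite) sum of the terms of half-order \<open>n\<close>.\<close>

definition half_order :: "'z gforest_scheme set \<Rightarrow> nat" where
  "half_order \<pi> = 2 * card (black (rep \<pi>)) + card (grafts (rep \<pi>))"

definition S_series ::
    "real \<Rightarrow> ((real^'d::finite) \<Rightarrow> real^'d) \<Rightarrow> real^'d \<Rightarrow> (gforest set \<Rightarrow> real) \<Rightarrow>
     ((real^'d) \<Rightarrow> real) \<Rightarrow> (real^'d) \<Rightarrow> nat \<Rightarrow> real" where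
  "S_series h f \<xi> a \<phi> x n =
     (\<Sum>\<pi> | \<pi> \<in> AFg \<and> half_order \<pi> = n. a \<pi> / real (sigma_g \<pi>) * F_grafted h f \<xi> \<pi> \<phi> x)"

definition ES_series ::
    "real \<Rightarrow> ((real^'d::finite) \<Rightarrow> real^'d) \<Rightarrow> (eforest set \<Rightarrow> real) \<Rightarrow>
     ((real^'d) \<Rightarrow> real) \<Rightarrow> (real^'d) \<Rightarrow> nat \<Rightarrow> real" where
  "ES_series h f b \<phi> x n =
     (\<Sum>\<pi> | \<pi> \<in> EF \<and> half_order \<pi> = n. b \<pi> / real (sigma_e \<pi>) * F_exotic h f \<pi> \<phi> x)"

definition formal_expectation :: "'w measure \<Rightarrow> ('w \<Rightarrow> nat \<Rightarrow> real) \<Rightarrow> nat \<Rightarrow> real" where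
  "formal_expectation M X n = (\<integral>\<omega>. X \<omega> n \<partial>M)"

definition standard_gaussian :: "'w measure \<Rightarrow> ('w \<Rightarrow> real^'d::finite) \<Rightarrow> bool" where
  "standard_gaussian M \<xi> \<longleftrightarrow>
     prob_space.indep_vars M (\<lambda>_. borel) (\<lambda>j \<omega>. \<xi> \<omega> $ j) UNIV \<and>
     (\<forall>j. distributed M lborel (\<lambda>\<omega>. \<xi> \<omega> $ j) std_normal_density)"

end

theory Submission
  imports Defs
begin

text \<open>By Isserlis' theorem the expectation of a product of Gaussian components over the grafted
  vertices counts the pairings whose pairs carry equal indices, so the expected operator of a
  grafted forest is the sum of the exotic operators over all pairings of its grafted vertices. The
  automorphism group of the grafted forest acts on these pairings; its orbits are the exotic
  forests above it and the stabilizers are their automorphism groups, so grouping the pairings by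
  orbit turns the coefficient \<open>1/sigma_g\<close> into \<open>1/sigma_e\<close>.

  The operators are invariant under isomorphisms because \<^const>\<open>partials\<close> depends only on the
  multiset of indices, so no reordering of derivatives occurs.\<close>

section \<open>Gaussian moments and perfect matchings\<close>

text \<open>The condition that \<open>exotic_forest\<close> puts on the lianas, stated for an
  arbitrary set so that a recursion can run through subsets of the grafted vertices.\<close>

definition perfect_matchings :: "'a set \<Rightarrow> 'a set set set" where
  "perfect_matchings A = {P. partition_on A P \<and> (\<forall>l\<in>P. card l = 2)}"

text \<open>Isolates the restriction on index maps in \<open>F_exotic\<close>. The count in
  Isserlis' theorem uses the same predicate, and this is where the two sides meet.\<close>

definition constant_on_blocks :: "('a \<Rightarrow> 'b) \<Rightarrow> 'a set set \<Rightarrow> bool" where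
  "constant_on_blocks i P \<longleftrightarrow> (\<forall>l\<in>P. \<forall>u\<in>l. \<forall>v\<in>l. i u = i v)"

lemma constant_on_blocks_insert_pair:
  "constant_on_blocks i (insert {u, v} P) \<longleftrightarrow> i u = i v \<and> constant_on_blocks i P"
proof -
  have insert: "(\<forall>l\<in>insert {u, v} P. R l) \<longleftrightarrow> R {u, v} \<and> (\<forall>l\<in>P. R l)" for R
    by simp
  have pair: "(\<forall>x\<in>{u, v}. \<forall>y\<in>{u, v}. i x = i y) \<longleftrightarrow> i u = i v"
    by auto
  have "constant_on_blocks i (insert {u, v} P) \<longleftrightarrow>
      (\<forall>x\<in>{u, v}. \<forall>y\<in>{u, v}. i x = i y) \<and> constant_on_blocks i P"
    unfolding constant_on_blocks_def by (rule insert)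
  then show ?thesis
    unfolding pair .
qed

lemma constant_on_blocks_empty [simp]: "constant_on_blocks i {}"
  by (simp add: constant_on_blocks_def)

lemma finite_perfect_matchings: "finite A \<Longrightarrow> finite (perfect_matchings A)"
  unfolding perfect_matchings_def
  by (rule finite_subset[OF _ finitely_many_partition_on]) auto

lemma insert_pair_perfect_matching:
  assumes "P \<in> perfect_matchings (A - {u, v})" "u \<in> A" "v \<in> A" "u \<noteq> v"
  shows "insert {u, v} P \<in> perfect_matchings A"
proof -
  have P: "partition_on (A - {u, v}) P" "\<forall>l\<in>P. card l = 2"
    using assms(1) by (auto simp: perfect_matchings_def)
  have U: "\<Union>P = A - {u, v}"
    using partition_onD1[OF P(1)] by simp
  then have "disjnt {u, v} (\<Union>P)"
    by (auto simp: disjnt_def)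
  then show ?thesis
    using P assms by (simp add: perfect_matchings_def partition_on_insert)
qed

lemma perfect_matching_remove_pair:
  assumes "P \<in> perfect_matchings A" "v \<in> A"
  obtains u Q where "u \<in> A - {v}" "Q \<in> perfect_matchings (A - {u, v})" "P = insert {u, v} Q"
proof -
  have P: "partition_on A P" "\<forall>l\<in>P. card l = 2"
    using assms(1) by (auto simp: perfect_matchings_def)
  have U: "\<Union>P = A" using partition_onD1[OF P(1)] by simp
  with assms obtain l where l: "l \<in> P" "v \<in> l" by blast
  with P(2) obtain u where u: "l = {u, v}" "u \<noteq> v"
    by (metis card_2_iff doubleton_eq_iff insertE singletonD)
  have ins: "P = insert {u, v} (P - {{u, v}})" using l u by auto
  have "disjnt {u, v} (\<Union>(P - {{u, v}}))"
    using partition_onD2[OF P(1)] l u by (fastforce simp: disjoint_def disjnt_def)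
  then have "P - {{u, v}} \<in> perfect_matchings (A - {u, v})"
    using P ins partition_on_insert[of "{u, v}" "P - {{u, v}}" A]
    by (simp add: perfect_matchings_def)
  moreover have "u \<in> A - {v}" using U l u by blast
  ultimately show ?thesis using that ins by blast
qed

text \<open>Matchings are sorted by the partner \<open>u\<close> of the fixed point
  \<open>v\<close>. Constancy on the block of \<open>v\<close> forces \<open>i u = i v\<close>; what
  remains is a matching of the other points, with no further constraint linking it to
  \<open>v\<close>.\<close>

lemma card_constant_matchings_rec:
  assumes "finite A" "v \<in> A"
  shows "card {P \<in> perfect_matchings A. constant_on_blocks i P} =
    (\<Sum>u | u \<in> A - {v} \<and> i u = i v.
       card {P \<in> perfect_matchings (A - {u, v}). constant_on_blocks i P})"
proof -
  define N where "N B = {P \<in> perfect_matchings B. constant_on_blocks i P}" for B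
  let ?B = "{u \<in> A - {v}. i u = i v}"
  let ?h = "\<lambda>(u, Q). insert {u, v} Q"
  have "bij_betw ?h (SIGMA u:?B. N (A - {u, v})) (N A)"
  proof (intro bij_betwI')
    fix x y assume "x \<in> (SIGMA u:?B. N (A - {u, v}))" "y \<in> (SIGMA u:?B. N (A - {u, v}))"
    then obtain u Q u' Q' where x: "x = (u, Q)" "u \<in> ?B" "Q \<in> N (A - {u, v})"
      and y: "y = (u', Q')" "u' \<in> ?B" "Q' \<in> N (A - {u', v})" by auto
    have Q: "\<Union>Q = A - {u, v}" "\<Union>Q' = A - {u', v}"
      using x y by (auto simp: N_def perfect_matchings_def dest: partition_onD1)
    show "(?h x = ?h y) = (x = y)"
    proof
      assume "?h x = ?h y"
      then have eq: "insert {u, v} Q = insert {u', v} Q'" by (simp add: x y)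
      \<comment> \<open>The blocks of \<open>Q\<close> and \<open>Q'\<close> all avoid
        \<open>v\<close>, so the inserted pair is the only block containing \<open>v\<close> on
        either side and determines the partner.\<close>
      have "{u, v} \<notin> Q'" "{u, v} \<notin> Q" "{u', v} \<notin> Q'" using Q by blast+
      with eq have "{u, v} = {u', v}" by blast
      then have "u = u'" by (auto simp: doubleton_eq_iff)
      with eq \<open>{u, v} \<notin> Q'\<close> \<open>{u, v} \<notin> Q\<close> have "Q = Q'" by (metis insert_ident)
      with \<open>u = u'\<close> show "x = y" by (simp add: x y)
    qed simp
  next
    fix x assume "x \<in> (SIGMA u:?B. N (A - {u, v}))"
    then obtain u Q where x: "x = (u, Q)" "u \<in> ?B" "Q \<in> N (A - {u, v})" by auto
    then have "insert {u, v} Q \<in> perfect_matchings A"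
      using assms by (intro insert_pair_perfect_matching) (auto simp: N_def)
    with x show "?h x \<in> N A"
      by (simp add: N_def constant_on_blocks_insert_pair)
  next
    fix P assume P: "P \<in> N A"
    then have "P \<in> perfect_matchings A" by (simp add: N_def)
    then obtain u Q where u: "u \<in> A - {v}" "Q \<in> perfect_matchings (A - {u, v})" "P = insert {u, v} Q"
      using \<open>v \<in> A\<close> by (rule perfect_matching_remove_pair)
    with P have "(u, Q) \<in> (SIGMA u:?B. N (A - {u, v}))"
      by (simp add: N_def constant_on_blocks_insert_pair)
    with u show "\<exists>x\<in>(SIGMA u:?B. N (A - {u, v})). P = ?h x" by force
  qed
  then have "card (N A) = card (SIGMA u:?B. N (A - {u, v}))"
    by (simp add: bij_betw_same_card)
  also have "\<dots> = (\<Sum>u\<in>?B. card (N (A - {u, v})))"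
    using assms by (intro card_SigmaI) (auto simp: N_def finite_perfect_matchings)
  finally show ?thesis by (simp add: N_def)
qed

text \<open>The hypothesis on \<open>m\<close> is the recursion of the moments of the standard normal distribution.\<close>

lemma card_constant_matchings_eq_prod:
  fixes m :: "nat \<Rightarrow> real" and i :: "'a \<Rightarrow> 'd::finite"
  assumes m: "m 0 = 1" "\<And>c. m (Suc c) = real c * m (c - 1)" and "finite A"
  shows "real (card {P \<in> perfect_matchings A. constant_on_blocks i P}) =
    (\<Prod>j\<in>UNIV. m (card {v \<in> A. i v = j}))"
  using \<open>finite A\<close>
proof (induction A rule: finite_psubset_induct)
  case (psubset A)
  show ?case
  proof (cases "A = {}")
    case True
    have "{P \<in> perfect_matchings {}. constant_on_blocks i P} = {{}}"
      by (auto simp: perfect_matchings_def partition_on_empty)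
    with True show ?thesis by (simp add: m)
  next
    case False
    then obtain v where v: "v \<in> A" by blast
    \<comment> \<open>\<open>B\<close> holds the possible partners of \<open>v\<close>, and
      \<open>R\<close> collects the factors of the index values other than \<open>i v\<close>, which
      removing \<open>u\<close> and \<open>v\<close> leaves unchanged.\<close>
    define B where "B = {u \<in> A - {v}. i u = i v}"
    define R where "R = (\<Prod>j\<in>UNIV - {i v}. m (card {w \<in> A. i w = j}))"
    have finB: "finite B" using psubset by (simp add: B_def)
    have step: "real (card {P \<in> perfect_matchings (A - {u, v}). constant_on_blocks i P}) =
        m (card B - 1) * R" if "u \<in> B" for u
    proof -
      have "A - {u, v} \<subset> A" using v by auto
      then have "real (card {P \<in> perfect_matchings (A - {u, v}). constant_on_blocks i P}) =
          (\<Prod>j\<in>UNIV. m (card {w \<in> A - {u, v}. i w = j}))"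
        by (rule psubset.IH)
      also have "\<dots> = m (card {w \<in> A - {u, v}. i w = i v}) *
          (\<Prod>j\<in>UNIV - {i v}. m (card {w \<in> A - {u, v}. i w = j}))"
        by (simp add: prod.remove[of UNIV "i v"])
      also have "{w \<in> A - {u, v}. i w = i v} = B - {u}" by (auto simp: B_def)
      also have "card (B - {u}) = card B - 1" using that by simp
      also have "(\<Prod>j\<in>UNIV - {i v}. m (card {w \<in> A - {u, v}. i w = j})) = R"
        unfolding R_def
      proof (intro prod.cong refl)
        fix j assume "j \<in> UNIV - {i v}"
        then have "{w \<in> A - {u, v}. i w = j} = {w \<in> A. i w = j}"
          using that by (auto simp: B_def)
        then show "m (card {w \<in> A - {u, v}. i w = j}) = m (card {w \<in> A. i w = j})" by simp
      qed
      finally show ?thesis .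
    qed
    \<comment> \<open>The index class of \<open>v\<close> has \<open>card B + 1\<close> elements, so
      the moment recursion yields the factor \<open>card B\<close>, which matches the number of
      partners; each of them leaves a class of size \<open>card B - 1\<close>.\<close>
    have "{w \<in> A. i w = i v} = insert v B" "v \<notin> B" using v by (auto simp: B_def)
    then have "m (card {w \<in> A. i w = i v}) = real (card B) * m (card B - 1)"
      using finB by (simp add: m)
    moreover have "real (card {P \<in> perfect_matchings A. constant_on_blocks i P}) =
        real (card B) * (m (card B - 1) * R)"
      unfolding card_constant_matchings_rec[OF psubset(1) v] B_def[symmetric] by (simp add: step)
    ultimately show ?thesis
      by (simp add: prod.remove[of UNIV "i v"] R_def)
  qed
qed

text \<open>For even \<open>c\<close> both exponents are odd and both moments vanish, except that
  for \<open>c = 0\<close> the right side vanishes through its factor \<open>c\<close>. For odd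
  \<open>c\<close> the claim is the ratio of consecutive closed forms (2k)!/(2^k k!).\<close>

lemma std_normal_moment_rec:
  "(\<integral>x. std_normal_density x * x ^ Suc c \<partial>lborel) =
    real c * (\<integral>x. std_normal_density x * x ^ (c - 1) \<partial>lborel)"
proof (cases "even c")
  case True
  then obtain k where c: "c = 2 * k" by blast
  show ?thesis
  proof (cases k)
    case 0
    then show ?thesis using integral_std_normal_moment_odd[of 0] by (simp add: c)
  next
    case (Suc l)
    have "Suc c = 2 * k + 1" "c - 1 = 2 * l + 1"
      by (simp_all add: c Suc)
    then show ?thesis
      by (simp only: integral_std_normal_moment_odd mult_zero_right)
  qed
next
  case False
  then obtain k where c: "c = 2 * k + 1" by (auto elim: oddE)
  have "(\<integral>x. std_normal_density x * x ^ Suc c \<partial>lborel) = fact (2 * Suc k) / (2 ^ Suc k * fact (Suc k))"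
    using integral_std_normal_moment_even[of "Suc k"] by (simp add: c)
  also have "\<dots> = real c * (fact (2 * k) / (2 ^ k * fact k))"
    by (simp add: c divide_simps)
  also have "\<dots> = real c * (\<integral>x. std_normal_density x * x ^ (c - 1) \<partial>lborel)"
    using integral_std_normal_moment_even[of k] by (simp add: c)
  finally show ?thesis .
qed

text \<open>Grouping the factors by coordinate turns the product into powers of independent
  variables, so the expectation is a product of one-dimensional moments. The number of matchings is
  the same product, because the moments satisfy its recursion.\<close>

lemma
  assumes "prob_space M" and "standard_gaussian M \<xi>" and "finite A"
  shows integrable_prod_gaussian: "integrable M (\<lambda>\<omega>. \<Prod>v\<in>A. \<xi> \<omega> $ i v)"
    and isserlis: "(\<integral>\<omega>. (\<Prod>v\<in>A. \<xi> \<omega> $ i v) \<partial>M) =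
      real (card {P \<in> perfect_matchings A. constant_on_blocks i P})"
proof -
  interpret prob_space M by fact
  define c where "c j = card {v \<in> A. i v = j}" for j
  have indep: "indep_vars (\<lambda>_. borel) (\<lambda>j \<omega>. \<xi> \<omega> $ j) UNIV"
    and dist: "\<And>j. distributed M lborel (\<lambda>\<omega>. \<xi> \<omega> $ j) std_normal_density"
    using assms(2) by (auto simp: standard_gaussian_def)
  have indep': "indep_vars (\<lambda>_. borel) (\<lambda>j \<omega>. (\<xi> \<omega> $ j) ^ c j) UNIV"
    by (rule indep_vars_compose2[OF indep]) measurable
  have int: "integrable M (\<lambda>\<omega>. (\<xi> \<omega> $ j) ^ c j)" for j
    using distributed_integrable[OF dist, of "\<lambda>x. x ^ c j" j] integrable_normal_moment[of 1 0 "c j"]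
    by simp
  have E: "(\<integral>\<omega>. (\<xi> \<omega> $ j) ^ c j \<partial>M) = (\<integral>x. std_normal_density x * x ^ c j \<partial>lborel)" for j
    using distributed_integral[OF dist, of "\<lambda>x. x ^ c j" j] by simp
  \<comment> \<open>Coordinates that \<open>i\<close> does not hit on \<open>A\<close> get exponent
    0 and contribute the factor 1.\<close>
  have prod: "(\<Prod>v\<in>A. \<xi> \<omega> $ i v) = (\<Prod>j\<in>UNIV. (\<xi> \<omega> $ j) ^ c j)" for \<omega>
  proof -
    have "(\<Prod>v\<in>A. \<xi> \<omega> $ i v) = (\<Prod>j\<in>UNIV. \<Prod>v | v \<in> A \<and> i v = j. \<xi> \<omega> $ i v)"
      using assms(3) by (intro prod.group[symmetric]) auto
    also have "\<dots> = (\<Prod>j\<in>UNIV. (\<xi> \<omega> $ j) ^ c j)"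
      by (intro prod.cong refl) (simp add: c_def)
    finally show ?thesis .
  qed
  show "integrable M (\<lambda>\<omega>. \<Prod>v\<in>A. \<xi> \<omega> $ i v)"
    unfolding prod using int indep' by (intro indep_vars_integrable) auto
  have "(\<integral>\<omega>. (\<Prod>v\<in>A. \<xi> \<omega> $ i v) \<partial>M) = (\<Prod>j\<in>UNIV. \<integral>\<omega>. (\<xi> \<omega> $ j) ^ c j \<partial>M)"
    unfolding prod using int indep' by (intro indep_vars_lebesgue_integral) auto
  also have "\<dots> = real (card {P \<in> perfect_matchings A. constant_on_blocks i P})"
    unfolding E unfolding c_def
    by (rule card_constant_matchings_eq_prod[symmetric])
      (use std_normal_moment_rec assms(3) in \<open>simp_all\<close>)
  finally show "(\<integral>\<omega>. (\<Prod>v\<in>A. \<xi> \<omega> $ i v) \<partial>M) =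
      real (card {P \<in> perfect_matchings A. constant_on_blocks i P})" .
qed

section \<open>Isomorphisms of forests\<close>

lemma partials_image:
  assumes "inj_on p U"
  shows "partials i (p ` U) g = partials (i \<circ> p) U g"
  by (simp add: partials_def flip: image_mset_mset_set[OF assms] multiset.map_comp)

lemma partials_cong:
  assumes "\<And>u. u \<in> U \<Longrightarrow> i u = j u"
  shows "partials i U = partials j U"
proof -
  \<comment> \<open>For infinite \<open>U\<close> the multiset \<open>mset_set U\<close> is empty,
    so the two images agree trivially.\<close>
  have "image_mset i (mset_set U) = image_mset j (mset_set U)"
    using assms by (intro image_mset_cong)
      (metis elem_mset_set finite_set_mset_mset_set infinite_set_mset_mset_set empty_iff)
  then show ?thesis by (simp add: partials_def fun_eq_iff)
qed

lemma grafted_forestD: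
  assumes "grafted_forest G"
  shows "finite (verts G)" "edges G \<subseteq> verts G \<times> verts G" "grafts G \<subseteq> verts G" "finite (grafts G)"
    "\<And>v. v \<in> grafts G \<Longrightarrow> preds G v = {}"
  using assms by (auto simp: grafted_forest_def aromatic_forest_def intro: finite_subset)

lemma exotic_forest_iff:
  "exotic_forest H \<longleftrightarrow> grafted_forest H \<and> lianas H \<in> perfect_matchings (grafts H)"
  by (auto simp: exotic_forest_def perfect_matchings_def)

lemma perfect_matchings_subset: "P \<in> perfect_matchings A \<Longrightarrow> P \<subseteq> Pow A"
  by (auto simp: perfect_matchings_def dest: partition_onD1)

lemma liana_subset_verts: "exotic_forest G \<Longrightarrow> l \<in> lianas G \<Longrightarrow> l \<subseteq> verts G"
  using perfect_matchings_subset grafted_forestD(3) by (fastforce simp: exotic_forest_iff)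

lemma perfect_matchings_image:
  assumes "P \<in> perfect_matchings A" "inj_on p A"
  shows "(\<lambda>l. p ` l) ` P \<in> perfect_matchings (p ` A)"
proof -
  have P: "partition_on A P" "\<And>l. l \<in> P \<Longrightarrow> card l = 2"
    using assms by (auto simp: perfect_matchings_def)
  have "{} \<notin> (`) p ` P" using partition_onD3[OF P(1)] by auto
  moreover have "card (p ` l) = 2" if "l \<in> P" for l
    using that P assms perfect_matchings_subset[OF assms(1)]
    by (metis PowD card_image inj_on_subset subsetD)
  ultimately show ?thesis
    using partition_on_inj_image[OF P(1) assms(2)] by (auto simp: perfect_matchings_def)
qed

lemma grafted_isomorphismD:
  assumes "grafted_isomorphism p G H"
  shows "bij_betw p (verts G) (verts H)" "inj_on p (verts G)" "verts H = p ` verts G"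
    "edges H = map_prod p p ` edges G" "grafts H = p ` grafts G"
  using assms by (auto simp: grafted_isomorphism_def bij_betw_def)

lemma grafted_isomorphism_id: "grafted_isomorphism id G G"
  by (simp add: grafted_isomorphism_def map_prod.id)

lemma grafted_isomorphism_comp:
  "grafted_isomorphism p G H \<Longrightarrow> grafted_isomorphism q H K \<Longrightarrow> grafted_isomorphism (q \<circ> p) G K"
  by (auto simp: grafted_isomorphism_def image_comp map_prod.comp intro: bij_betw_trans)

lemma grafted_isomorphism_inv:
  assumes "grafted_isomorphism p G H" "grafted_forest G"
  shows "grafted_isomorphism (inv_into (verts G) p) H G"
proof -
  note D = grafted_isomorphismD[OF assms(1)] grafted_forestD[OF assms(2)]
  let ?q = "inv_into (verts G) p"
  have q: "?q (p v) = v" if "v \<in> verts G" for v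
    using that D(2) by simp
  have "map_prod ?q ?q ` edges H = (\<lambda>e. e) ` edges G"
    unfolding D(4) image_image by (intro image_cong refl) (use D(7) q in auto)
  moreover have "?q ` grafts H = (\<lambda>v. v) ` grafts G"
    unfolding D(5) image_image by (intro image_cong refl) (use D(8) q in auto)
  ultimately show ?thesis
    using bij_betw_inv_into[OF D(1)] by (simp add: grafted_isomorphism_def)
qed

text \<open>Isomorphisms are total functions on the naturals of which only the values on vertices
  matter. This permits passing between permutations that are the identity off the vertices and
  extensional maps, so that each isomorphism is counted once.\<close>

lemma grafted_isomorphism_cong:
  assumes "grafted_forest G" "\<And>v. v \<in> verts G \<Longrightarrow> p v = q v"
  shows "grafted_isomorphism p G H \<longleftrightarrow> grafted_isomorphism q G H"
proof -
  note D = grafted_forestD[OF assms(1)]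
  have "map_prod p p ` edges G = map_prod q q ` edges G"
    by (intro image_cong refl) (use D(2) assms(2) in auto)
  moreover have "p ` grafts G = q ` grafts G"
    by (intro image_cong refl) (use D(3) assms(2) in auto)
  moreover have "bij_betw p (verts G) (verts H) = bij_betw q (verts G) (verts H)"
    by (intro bij_betw_cong assms(2))
  ultimately show ?thesis by (simp add: grafted_isomorphism_def)
qed

lemma exotic_isomorphism_cong:
  assumes "exotic_forest G" "\<And>v. v \<in> verts G \<Longrightarrow> p v = q v"
  shows "exotic_isomorphism p G H \<longleftrightarrow> exotic_isomorphism q G H"
proof -
  have G: "grafted_forest G" using assms(1) by (simp add: exotic_forest_def)
  have "l \<subseteq> verts G" if "l \<in> lianas G" for l
    using liana_subset_verts[OF assms(1) that] .
  then have "(\<lambda>l. p ` l) ` lianas G = (\<lambda>l. q ` l) ` lianas G"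
    using assms(2) by (intro image_cong refl) blast
  then show ?thesis
    using grafted_isomorphism_cong[OF G assms(2)] by (simp add: exotic_isomorphism_def)
qed

lemma exotic_isomorphism_id: "exotic_isomorphism id G G"
  by (simp add: exotic_isomorphism_def grafted_isomorphism_id)

lemma exotic_isomorphism_comp:
  "exotic_isomorphism p G H \<Longrightarrow> exotic_isomorphism q H K \<Longrightarrow> exotic_isomorphism (q \<circ> p) G K"
  by (auto simp: exotic_isomorphism_def image_comp comp_def intro: grafted_isomorphism_comp[unfolded comp_def])

lemma exotic_isomorphism_inv:
  assumes "exotic_isomorphism p G H" "exotic_forest G"
  shows "exotic_isomorphism (inv_into (verts G) p) H G"
proof -
  have G: "grafted_forest G" and p: "grafted_isomorphism p G H"
    and lH: "lianas H = (\<lambda>l. p ` l) ` lianas G"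
    using assms by (auto simp: exotic_forest_def exotic_isomorphism_def)
  let ?q = "inv_into (verts G) p"
  have "l \<subseteq> verts G" if "l \<in> lianas G" for l
    using liana_subset_verts[OF assms(2) that] .
  then have "(\<lambda>l. ?q ` l) ` lianas H = (\<lambda>l. l) ` lianas G"
    unfolding lH image_image[of _ "\<lambda>l. p ` l"]
    by (intro image_cong refl inv_into_image_cancel[OF grafted_isomorphismD(2)[OF p]])
  then show ?thesis
    using grafted_isomorphism_inv[OF p G] by (simp add: exotic_isomorphism_def)
qed

section \<open>Isomorphism classes and their representatives\<close>

lemma equiv_grafted_iso: "equiv {G. grafted_forest G} grafted_iso"
proof (rule equivI)
  show "sym grafted_iso"
    by (rule symI) (auto simp: grafted_iso_def intro: grafted_isomorphism_inv)
  show "trans grafted_iso"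
    by (rule transI) (auto simp: grafted_iso_def intro: grafted_isomorphism_comp)
qed (auto simp: grafted_iso_def refl_on_def intro: grafted_isomorphism_id)

lemma equiv_exotic_iso: "equiv {G. exotic_forest G} exotic_iso"
proof (rule equivI)
  show "sym exotic_iso"
    by (rule symI) (auto simp: exotic_iso_def intro: exotic_isomorphism_inv)
  show "trans exotic_iso"
    by (rule transI) (auto simp: exotic_iso_def intro: exotic_isomorphism_comp)
qed (auto simp: exotic_iso_def refl_on_def intro: exotic_isomorphism_id)

lemma rep_in_quotient:
  assumes "equiv A r" "\<pi> \<in> A // r"
  shows "rep \<pi> \<in> \<pi>" "rep \<pi> \<in> A" "r `` {rep \<pi>} = \<pi>"
proof -
  have "\<exists>G. G \<in> \<pi>" using assms in_quotient_imp_non_empty by blast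
  then show *: "rep \<pi> \<in> \<pi>" unfolding rep_def by (rule someI_ex)
  show "rep \<pi> \<in> A" using * assms in_quotient_imp_subset by blast
  show "r `` {rep \<pi>} = \<pi>"
    using assms * by (metis Image_singleton_iff equiv_class_eq quotientE)
qed

lemmas rep_AFg = rep_in_quotient[OF equiv_grafted_iso, folded AFg_def]
lemmas rep_EF = rep_in_quotient[OF equiv_exotic_iso, folded EF_def]

section \<open>Transport of the graph structure along isomorphisms\<close>

lemma grafted_isomorphism_preds:
  assumes "grafted_isomorphism p G H" "grafted_forest G" "v \<in> verts G"
  shows "preds H (p v) = p ` preds G v"
proof -
  note D = grafted_isomorphismD[OF assms(1)] grafted_forestD[OF assms(2)]
  have "u \<in> preds H (p v) \<longleftrightarrow> u \<in> p ` preds G v" for u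
  proof
    assume "u \<in> preds H (p v)"
    then obtain a b where "(a, b) \<in> edges G" "p a = u" "p b = p v"
      by (auto simp: preds_def D(4))
    moreover from this have "b = v" using D(7) assms(3) inj_onD[OF D(2)] by blast
    ultimately show "u \<in> p ` preds G v" by (auto simp: preds_def)
  qed (force simp: preds_def D(4))
  then show ?thesis by blast
qed

lemma grafted_isomorphism_roots:
  assumes "grafted_isomorphism p G H" "grafted_forest G"
  shows "roots H = p ` roots G"
proof -
  note D = grafted_isomorphismD[OF assms(1)] grafted_forestD[OF assms(2)]
  have "Domain (edges G) \<subseteq> verts G" using D(7) by auto
  moreover have "Domain (edges H) = p ` Domain (edges G)"
    unfolding D(4) by force
  moreover have "roots G = verts G - Domain (edges G)" "roots H = verts H - Domain (edges H)"
    by (auto simp: roots_def)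
  ultimately show ?thesis
    using inj_on_image_set_diff[OF D(2), of "verts G" "Domain (edges G)"] by (simp add: D(3))
qed

lemma grafted_isomorphism_black:
  assumes "grafted_isomorphism p G H" "grafted_forest G"
  shows "black H = p ` black G"
proof -
  note D = grafted_isomorphismD[OF assms(1)] grafted_forestD[OF assms(2)]
  show ?thesis
    using inj_on_image_set_diff[OF D(2), of "verts G" "grafts G"] D(8) by (simp add: black_def D(3,5))
qed

text \<open>Needed for relabelling: \<open>grafted_iso\<close> relates only graphs already known to
  be grafted forests, so a relabelled copy must be shown to be one.\<close>

lemma grafted_isomorphism_grafted_forest:
  assumes p: "grafted_isomorphism p G H" and G: "grafted_forest G"
  shows "grafted_forest H"
proof -
  note D = grafted_isomorphismD[OF p] grafted_forestD[OF G]
  have "single_valued (edges H)"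
  proof (rule single_valuedI)
    fix u v w assume "(u, v) \<in> edges H" "(u, w) \<in> edges H"
    then obtain a b c d where "(a, b) \<in> edges G" "(c, d) \<in> edges G"
      "p a = u" "p c = u" "p b = v" "p d = w"
      by (auto simp: D(4))
    moreover from this have "a = c" using D(7) inj_onD[OF D(2)] by blast
    ultimately show "v = w"
      using G by (metis aromatic_forest_def grafted_forest_def single_valuedD)
  qed
  moreover have "edges H \<subseteq> verts H \<times> verts H" using D(7) by (auto simp: D(3,4))
  moreover have "verts H = {} \<or> roots H \<noteq> {}"
    using G by (auto simp: grafted_isomorphism_roots[OF p G] D(3) grafted_forest_def aromatic_forest_def)
  moreover have "\<forall>v\<in>grafts H. preds H v = {}"
    using D(8,10) grafted_isomorphism_preds[OF p G] by (fastforce simp: D(5))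
  moreover have "grafts H \<subseteq> verts H" using D(8) by (auto simp: D(3,5))
  ultimately show ?thesis
    using D(6) by (simp add: grafted_forest_def aromatic_forest_def D(3))
qed

lemma grafted_isomorphism_half_order:
  assumes "grafted_isomorphism p G H" "grafted_forest G"
  shows "2 * card (black H) + card (grafts H) = 2 * card (black G) + card (grafts G)"
proof -
  note D = grafted_isomorphismD[OF assms(1)] grafted_forestD[OF assms(2)]
  have "card (black H) = card (black G)"
    unfolding grafted_isomorphism_black[OF assms]
    by (intro card_image inj_on_subset[OF D(2)]) (auto simp: black_def)
  moreover have "card (grafts H) = card (grafts G)"
    unfolding D(5) by (intro card_image inj_on_subset[OF D(2)] D(8))
  ultimately show ?thesis by simp
qed

section \<open>Pairing the grafted vertices and forgetting the pairing\<close>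

definition pairing :: "gforest \<Rightarrow> nat set set \<Rightarrow> eforest" where
  "pairing G P = \<lparr>verts = verts G, edges = edges G, grafts = grafts G, lianas = P\<rparr>"

lemma pairing_simps [simp]:
  "verts (pairing G P) = verts G" "edges (pairing G P) = edges G"
  "grafts (pairing G P) = grafts G" "lianas (pairing G P) = P"
  "black (pairing G P) = black G" "preds (pairing G P) = preds G" "roots (pairing G P) = roots G"
  "gforest.truncate (pairing G P) = G"
  by (simp_all add: pairing_def black_def preds_def[abs_def] roots_def gforest.truncate_def)

lemma truncate_simps [simp]:
  fixes H :: eforest
  shows "verts (gforest.truncate H) = verts H" "edges (gforest.truncate H) = edges H"
    "grafts (gforest.truncate H) = grafts H" "black (gforest.truncate H) = black H"
    "preds (gforest.truncate H) = preds H" "roots (gforest.truncate H) = roots H"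
  by (simp_all add: black_def preds_def[abs_def] roots_def gforest.truncate_def)

lemma grafted_forest_truncate [simp]:
  fixes H :: eforest
  shows "grafted_forest (gforest.truncate H) = grafted_forest H"
  by (simp add: grafted_forest_def aromatic_forest_def)

lemma grafted_forest_pairing [simp]: "grafted_forest (pairing G P) = grafted_forest G"
  by (simp add: grafted_forest_def aromatic_forest_def)

lemma exotic_forest_pairing:
  "exotic_forest (pairing G P) \<longleftrightarrow> grafted_forest G \<and> P \<in> perfect_matchings (grafts G)"
  by (simp add: exotic_forest_iff)

text \<open>Presents the exotic isomorphisms onto \<open>pairing G P\<close> as the fibre over
  \<open>P\<close> of the map sending a graph isomorphism to the image of the lianas. The orbit
  count rests on these fibres.\<close>

lemma exotic_isomorphism_pairing:
  "exotic_isomorphism p H (pairing G P) \<longleftrightarrow>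
     grafted_isomorphism p (gforest.truncate H) G \<and> (\<lambda>l. p ` l) ` lianas H = P"
  by (auto simp: exotic_isomorphism_def grafted_isomorphism_def)

text \<open>Isomorphic exotic forests have isomorphic truncations, so the union defining \<Phi>
  collapses to a single class.\<close>

lemma forget_class:
  assumes "exotic_forest H"
  shows "\<Phi> (exotic_iso `` {H}) = grafted_iso `` {gforest.truncate H}"
proof -
  have "(gforest.truncate H, gforest.truncate K) \<in> grafted_iso" if "(H, K) \<in> exotic_iso" for K
    using that by (auto simp: exotic_iso_def grafted_iso_def exotic_forest_def
        exotic_isomorphism_def grafted_isomorphism_def)
  then have "grafted_iso `` {gforest.truncate K} = grafted_iso `` {gforest.truncate H}"
    if "(H, K) \<in> exotic_iso" for K
    using that equiv_class_eq[OF equiv_grafted_iso] by metis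
  moreover have "(H, H) \<in> exotic_iso"
    using assms by (auto simp: exotic_iso_def intro: exotic_isomorphism_id)
  ultimately show ?thesis unfolding forget_def by blast
qed

text \<open>The representatives of \<rho> and of \<Phi> \<rho> are chosen independently, so the
  truncation of the first is only isomorphic to the second. The third claim supplies the
  bridge.\<close>

lemma forget_EF:
  assumes "\<rho> \<in> EF"
  shows "\<Phi> \<rho> \<in> AFg" "half_order (\<Phi> \<rho>) = half_order \<rho>"
    "\<exists>q. grafted_isomorphism q (gforest.truncate (rep \<rho>)) (rep (\<Phi> \<rho>))"
proof -
  have H: "exotic_forest (rep \<rho>)" using rep_EF(2)[OF assms] by simp
  then have G: "grafted_forest (gforest.truncate (rep \<rho>))" by (simp add: exotic_forest_def)
  have eq: "\<Phi> \<rho> = grafted_iso `` {gforest.truncate (rep \<rho>)}"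
    using forget_class[OF H] rep_EF(3)[OF assms] by simp
  then show AFg: "\<Phi> \<rho> \<in> AFg" using G by (simp add: AFg_def quotientI)
  from rep_AFg(1)[OF this] eq
  show ex: "\<exists>q. grafted_isomorphism q (gforest.truncate (rep \<rho>)) (rep (\<Phi> \<rho>))"
    by (auto simp: grafted_iso_def)
  then show "half_order (\<Phi> \<rho>) = half_order \<rho>"
    using grafted_isomorphism_half_order[OF _ G] by (auto simp: half_order_def)
qed

section \<open>Counting automorphisms\<close>

text \<open>The isomorphisms from \<open>G\<close> to the representative form a torsor under the
  automorphisms of the representative, acting by composition on the left; \<open>q\<close> is the
  base point.\<close>

lemma bij_betw_automorphisms_grafted_isomorphisms:
  assumes "grafted_isomorphism q G (rep \<pi>)" "grafted_forest G"
  shows "bij_betw (\<lambda>r. restrict (r \<circ> q) (verts G))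
    {r. r permutes verts (rep \<pi>) \<and> grafted_isomorphism r (rep \<pi>) (rep \<pi>)}
    {p \<in> extensional (verts G). grafted_isomorphism p G (rep \<pi>)}"
proof -
  define W where "W = verts (rep \<pi>)"
  note D = grafted_isomorphismD[OF assms(1), folded W_def]
  let ?inv = "inv_into (verts G) q"
  have q_inv: "q (?inv w) = w" "?inv w \<in> verts G" if "w \<in> W" for w
    using that D(3) by (auto intro: f_inv_into_f inv_into_into)
  show ?thesis
    unfolding W_def[symmetric]
  proof (intro bij_betwI', goal_cases)
    case (1 r s)
    show ?case
    proof
      assume eq: "restrict (r \<circ> q) (verts G) = restrict (s \<circ> q) (verts G)"
      have "r w = s w" for w
      proof (cases "w \<in> W")
        case True
        then show ?thesis using fun_cong[OF eq, of "?inv w"] q_inv by simp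
      qed (use 1 in \<open>auto simp: permutes_not_in\<close>)
      then show "r = s" by blast
    qed simp
  next
    case (2 r)
    then have "grafted_isomorphism (r \<circ> q) G (rep \<pi>)"
      using grafted_isomorphism_comp[OF assms(1)] by blast
    then show ?case
      using grafted_isomorphism_cong[OF assms(2), of "restrict (r \<circ> q) (verts G)" "r \<circ> q"] by simp
  next
    case (3 p)
    \<comment> \<open>The only candidate is \<open>p\<close> after the inverse of \<open>q\<close>,
      extended by the identity to a permutation.\<close>
    define r where "r w = (if w \<in> W then p (?inv w) else w)" for w
    note P = grafted_isomorphismD[of p G "rep \<pi>", folded W_def]
    have "bij_betw (p \<circ> ?inv) W W"
      using 3 P(1) bij_betw_inv_into[OF D(1)] by (auto intro: bij_betw_trans)
    then have "bij_betw r W W"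
      by (rule bij_betw_cong[THEN iffD1, rotated]) (simp add: r_def)
    then have "r permutes W"
      by (rule bij_imp_permutes) (simp add: r_def)
    moreover have rq: "(r \<circ> q) v = p v" if "v \<in> verts G" for v
      using that D(2,3) by (simp add: r_def)
    moreover have "grafted_isomorphism r (rep \<pi>) (rep \<pi>)"
    proof -
      have "grafted_isomorphism (r \<circ> q) G (rep \<pi>)"
        using grafted_isomorphism_cong[OF assms(2), of "r \<circ> q" p "rep \<pi>"] rq 3 by blast
      then have "edges (rep \<pi>) = map_prod r r ` map_prod q q ` edges G"
        and "grafts (rep \<pi>) = r ` q ` grafts G"
        by (auto simp: grafted_isomorphism_def image_comp map_prod.comp)
      then show ?thesis
        using \<open>bij_betw r W W\<close> unfolding grafted_isomorphism_def W_def D(4,5)[symmetric] by simp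
    qed
    moreover have "p = restrict (r \<circ> q) (verts G)"
      using rq 3 by (auto simp: restrict_def extensional_def fun_eq_iff)
    ultimately show ?case by blast
  qed
qed

text \<open>The torsor property again, now with automorphisms of the source acting on the right:
  \<open>sigma_e\<close> is read off at the representative of \<rho>, while the target is a pairing
  of another graph.\<close>

lemma bij_betw_automorphisms_exotic_isomorphisms:
  assumes q: "exotic_isomorphism q (rep \<rho>) K" and H: "exotic_forest (rep \<rho>)"
  shows "bij_betw (\<lambda>r. restrict (q \<circ> r) (verts (rep \<rho>)))
    {r. r permutes verts (rep \<rho>) \<and> exotic_isomorphism r (rep \<rho>) (rep \<rho>)}
    {p \<in> extensional (verts (rep \<rho>)). exotic_isomorphism p (rep \<rho>) K}"
proof -
  define H' where "H' = rep \<rho>"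
  note q' = q[folded H'_def] and H' = H[folded H'_def]
  have gq: "grafted_isomorphism q H' K" using q' by (simp add: exotic_isomorphism_def)
  note D = grafted_isomorphismD[OF gq]
  let ?inv = "inv_into (verts H') q"
  show ?thesis
    unfolding H'_def[symmetric]
  proof (intro bij_betwI', goal_cases)
    case (1 r s)
    show ?case
    proof
      assume eq: "restrict (q \<circ> r) (verts H') = restrict (q \<circ> s) (verts H')"
      have "r w = s w" for w
      proof (cases "w \<in> verts H'")
        case True
        then have "q (r w) = q (s w)" using fun_cong[OF eq, of w] by simp
        moreover have "r w \<in> verts H'" "s w \<in> verts H'"
          using 1 True by (auto simp: permutes_in_image)
        ultimately show ?thesis using D(2) by (auto dest: inj_onD)
      qed (use 1 in \<open>auto simp: permutes_not_in\<close>)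
      then show "r = s" by blast
    qed simp
  next
    case (2 r)
    then have "exotic_isomorphism (q \<circ> r) H' K"
      using exotic_isomorphism_comp[OF _ q'] by blast
    then show ?case
      using exotic_isomorphism_cong[OF H', of "restrict (q \<circ> r) (verts H')" "q \<circ> r"] by simp
  next
    case (3 p)
    then have p: "exotic_isomorphism p H' K" "p \<in> extensional (verts H')" by auto
    define r where "r w = (if w \<in> verts H' then ?inv (p w) else w)" for w
    have "exotic_isomorphism (?inv \<circ> p) H' H'"
      using exotic_isomorphism_comp[OF p(1) exotic_isomorphism_inv[OF q' H']] .
    then have r: "exotic_isomorphism r H' H'"
      by (rule exotic_isomorphism_cong[OF H', THEN iffD1, rotated]) (simp add: r_def)
    then have "bij_betw r (verts H') (verts H')"
      by (auto simp: exotic_isomorphism_def grafted_isomorphism_def)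
    then have "r permutes verts H'"
      by (rule bij_imp_permutes) (simp add: r_def)
    moreover have "p v \<in> verts K" if "v \<in> verts H'" for v
      using that p(1) by (auto simp: exotic_isomorphism_def dest: grafted_isomorphismD(3))
    then have "p = restrict (q \<circ> r) (verts H')"
      using p(2) D(3) by (auto simp: r_def restrict_def extensional_def fun_eq_iff f_inv_into_f)
    ultimately show ?case using r by blast
  qed
qed

lemma finite_automorphisms: "finite A \<Longrightarrow> finite {p. p permutes A \<and> R p}"
  by (rule finite_subset[OF _ finite_permutations]) auto

text \<open>Orbit counting: the isomorphisms from a representative of \<open>\<rho>\<close> to the representative of
  \<open>\<Phi> \<rho>\<close> carry its lianas to the pairings in \<open>\<rho>\<close>, and each pairing is hit \<open>sigma_e \<rho>\<close> times.\<close>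

lemma sigma_g_forget:
  assumes \<rho>: "\<rho> \<in> EF"
    and S: "S = {P \<in> perfect_matchings (grafts (rep (\<Phi> \<rho>))). pairing (rep (\<Phi> \<rho>)) P \<in> \<rho>}"
  shows "sigma_g (\<Phi> \<rho>) = card S * sigma_e \<rho>" and "sigma_g (\<Phi> \<rho>) > 0"
proof -
  define H where "H = rep \<rho>"
  define G where "G = rep (\<Phi> \<rho>)"
  have H: "exotic_forest H" "grafted_forest H" and H_class: "exotic_iso `` {H} = \<rho>"
    using rep_EF[OF \<rho>] by (auto simp: H_def exotic_forest_def)
  have G: "grafted_forest G" using rep_AFg(2)[OF forget_EF(1)[OF \<rho>]] by (simp add: G_def)
  obtain q where q: "grafted_isomorphism q (gforest.truncate H) G"
    using forget_EF(3)[OF \<rho>] by (auto simp: H_def G_def)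
  define B where "B = {p \<in> extensional (verts H). grafted_isomorphism p (gforest.truncate H) G}"
  define im where "im p = (\<lambda>l. p ` l) ` lianas H" for p :: "nat \<Rightarrow> nat"
  have bij: "bij_betw (\<lambda>r. restrict (r \<circ> q) (verts H))
      {r. r permutes verts G \<and> grafted_isomorphism r G G} B"
    using bij_betw_automorphisms_grafted_isomorphisms[of q "gforest.truncate H" "\<Phi> \<rho>"] q H(2)
    by (simp add: B_def G_def)
  have fin: "finite {r. r permutes verts G \<and> grafted_isomorphism r G G}"
    using grafted_forestD(1)[OF G] by (rule finite_automorphisms)
  have sigma_g: "sigma_g (\<Phi> \<rho>) = card B" and "finite B"
    using bij_betw_same_card[OF bij] bij_betw_finite[OF bij] fin by (simp_all add: sigma_g_def G_def)
  have "finite S"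
    using grafted_forestD(4)[OF G] by (simp add: S G_def finite_perfect_matchings)
  \<comment> \<open>An isomorphism transports the perfect matching of \<open>H\<close> to one of
    \<open>G\<close>, so the matching condition in \<open>S\<close> follows from the
    isomorphism.\<close>
  have in_S: "P \<in> S \<longleftrightarrow> (\<exists>p. exotic_isomorphism p H (pairing G P))" for P
  proof -
    have "P \<in> S \<longleftrightarrow> pairing G P \<in> exotic_iso `` {H} \<and> P \<in> perfect_matchings (grafts G)"
      by (auto simp: S G_def H_class)
    also have "\<dots> \<longleftrightarrow> P \<in> perfect_matchings (grafts G) \<and> (\<exists>p. exotic_isomorphism p H (pairing G P))"
      using H G by (auto simp: exotic_iso_def exotic_forest_pairing)
    also have "\<dots> \<longleftrightarrow> (\<exists>p. exotic_isomorphism p H (pairing G P))"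
    proof -
      have "P \<in> perfect_matchings (grafts G)" if "exotic_isomorphism p H (pairing G P)" for p
      proof -
        have p: "grafted_isomorphism p (gforest.truncate H) G" "P = im p"
          using that by (auto simp: exotic_isomorphism_pairing im_def)
        have "inj_on p (grafts H)"
          using grafted_isomorphismD(2)[OF p(1)] grafted_forestD(3)[OF H(2)] by (auto intro: inj_on_subset)
        then show ?thesis
          using perfect_matchings_image[of "lianas H" "grafts H" p] H(1) grafted_isomorphismD(5)[OF p(1)]
          by (simp add: exotic_forest_iff p(2) im_def)
      qed
      then show ?thesis by blast
    qed
    finally show ?thesis .
  qed
  have "im ` B \<subseteq> S"
    using in_S by (auto simp: B_def im_def exotic_isomorphism_pairing)
  \<comment> \<open>The fibre of \<open>im\<close> over \<open>P\<close> is a nonempty torsor under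
    the automorphisms of \<open>H\<close>, hence its size is the same for every \<open>P\<close> in
    \<open>S\<close>.\<close>
  moreover have "card {p \<in> B. im p = P} = sigma_e \<rho>" if P: "P \<in> S" for P
  proof -
    obtain p where p: "exotic_isomorphism p H (pairing G P)" using P in_S by blast
    have "{p \<in> B. im p = P} = {p \<in> extensional (verts H). exotic_isomorphism p H (pairing G P)}"
      by (auto simp: B_def im_def exotic_isomorphism_pairing)
    then show ?thesis
      using bij_betw_same_card[OF bij_betw_automorphisms_exotic_isomorphisms[of p \<rho>]] p H
      by (simp add: sigma_e_def H_def)
  qed
  ultimately have "(\<Sum>P\<in>S. sigma_e \<rho>) = (\<Sum>p\<in>B. 1)"
    using sum.group[OF \<open>finite B\<close> \<open>finite S\<close>, of im "\<lambda>_. 1::nat"] by simp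
  then show "sigma_g (\<Phi> \<rho>) = card S * sigma_e \<rho>" using sigma_g by simp
  \<comment> \<open>Positivity makes both factors of the product formula nonzero: it justifies
    cancelling later and shows that \<open>S\<close> is nonempty.\<close>
  have "id \<in> {r. r permutes verts G \<and> grafted_isomorphism r G G}"
    by (auto simp: permutes_id grafted_isomorphism_id)
  then show "sigma_g (\<Phi> \<rho>) > 0"
    using fin unfolding sigma_g_def G_def[symmetric] card_gt_0_iff by blast
qed

section \<open>Expectation of the differential operators\<close>

text \<open>The part of a summand of the elementary differential that does not involve the Gaussian
  vector.\<close>

definition black_diff ::
    "real \<Rightarrow> ((real^'d::finite) \<Rightarrow> real^'d) \<Rightarrow> ((real^'d) \<Rightarrow> real) \<Rightarrow> (real^'d) \<Rightarrow>
     'z gforest_scheme \<Rightarrow> (nat \<Rightarrow> 'd) \<Rightarrow> real" where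
  "black_diff h f \<phi> x G i =
     (\<Prod>v\<in>black G. partials i (preds G v) (\<lambda>y. (h *\<^sub>R f y) $ i v) x) * partials i (roots G) \<phi> x"

text \<open>The exotic operator on a labelled forest instead of a class, since a pairing of a
  representative need not be the representative of its own class.\<close>

definition exotic_diff ::
    "real \<Rightarrow> ((real^'d::finite) \<Rightarrow> real^'d) \<Rightarrow> ((real^'d) \<Rightarrow> real) \<Rightarrow> (real^'d) \<Rightarrow> eforest \<Rightarrow> real" where
  "exotic_diff h f \<phi> x G =
     (\<Sum>i | i \<in> verts G \<rightarrow>\<^sub>E UNIV \<and> constant_on_blocks i (lianas G).
        black_diff h f \<phi> x G i * sqrt (2 * h) ^ card (grafts G))"

lemma black_diff_cong:
  assumes "grafted_forest G" "\<And>v. v \<in> verts G \<Longrightarrow> i v = j v"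
  shows "black_diff h f \<phi> x G i = black_diff h f \<phi> x G j"
proof -
  have "preds G v \<subseteq> verts G" for v
    using grafted_forestD(2)[OF assms(1)] by (auto simp: preds_def)
  then have "partials i (preds G v) = partials j (preds G v)" for v
    by (intro partials_cong assms(2)) auto
  moreover have "partials i (roots G) = partials j (roots G)"
    by (intro partials_cong assms(2)) (auto simp: roots_def)
  ultimately show ?thesis
    using assms(2) unfolding black_diff_def
    by (intro arg_cong2[where f = "(*)"] prod.cong) (auto simp: black_def)
qed

lemma black_diff_isomorphism:
  assumes "grafted_isomorphism p G H" "grafted_forest G"
  shows "black_diff h f \<phi> x H i = black_diff h f \<phi> x G (i \<circ> p)"
proof -
  note D = grafted_isomorphismD[OF assms(1)] grafted_forestD[OF assms(2)]
  have inj: "inj_on p (black G)" "inj_on p (roots G)" "inj_on p (preds G v)" for v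
    using D(7) by (auto intro!: inj_on_subset[OF D(2)] simp: black_def roots_def preds_def)
  have "(\<Prod>v\<in>black H. partials i (preds H v) (\<lambda>y. (h *\<^sub>R f y) $ i v) x) =
      (\<Prod>v\<in>black G. partials (i \<circ> p) (preds G v) (\<lambda>y. (h *\<^sub>R f y) $ (i \<circ> p) v) x)"
    unfolding grafted_isomorphism_black[OF assms] prod.reindex[OF inj(1)] comp_def[of _ p]
    by (intro prod.cong refl)
      (simp add: black_def grafted_isomorphism_preds[OF assms] partials_image[OF inj(3)] comp_def)
  then show ?thesis
    by (simp add: black_diff_def grafted_isomorphism_roots[OF assms] partials_image[OF inj(2)])
qed

text \<open>A grafted vertex has no predecessors, so no derivative falls on its vector and it
  contributes a bare component of \<open>w\<close>. Both kinds of operator are instances, with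
  \<open>w\<close> random or constant.\<close>

lemma elem_diff_eq_black_diff:
  assumes "grafted_forest G"
  shows "elem_diff (\<lambda>v y. if v \<in> grafts G then w else h *\<^sub>R f y) I G \<phi> x =
    (\<Sum>i\<in>I. black_diff h f \<phi> x G i * (\<Prod>v\<in>grafts G. w $ i v))"
proof -
  note D = grafted_forestD[OF assms]
  have "(\<Prod>v\<in>verts G. partials i (preds G v) (\<lambda>y. (if v \<in> grafts G then w else h *\<^sub>R f y) $ i v) x) =
      (\<Prod>v\<in>black G. partials i (preds G v) (\<lambda>y. (h *\<^sub>R f y) $ i v) x) * (\<Prod>v\<in>grafts G. w $ i v)" for i
  proof -
    have "(\<Prod>v\<in>verts G. partials i (preds G v) (\<lambda>y. (if v \<in> grafts G then w else h *\<^sub>R f y) $ i v) x) =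
      (\<Prod>v\<in>verts G - grafts G. partials i (preds G v) (\<lambda>y. (if v \<in> grafts G then w else h *\<^sub>R f y) $ i v) x) *
      (\<Prod>v\<in>grafts G. partials i (preds G v) (\<lambda>y. (if v \<in> grafts G then w else h *\<^sub>R f y) $ i v) x)"
      using D(1,3) by (intro prod.subset_diff)
    also have "\<dots> = (\<Prod>v\<in>black G. partials i (preds G v) (\<lambda>y. (h *\<^sub>R f y) $ i v) x) * (\<Prod>v\<in>grafts G. w $ i v)"
      by (intro arg_cong2[where f = "(*)"] prod.cong) (auto simp: black_def D(5) partials_def)
    finally show ?thesis .
  qed
  then show ?thesis
    by (simp add: elem_diff_def black_diff_def mult.commute mult.left_commute)
qed

lemma F_exotic_eq:
  assumes "\<rho> \<in> EF"
  shows "F_exotic h f \<rho> \<phi> x = exotic_diff h f \<phi> x (rep \<rho>)"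
proof -
  have "grafted_forest (rep \<rho>)" using rep_EF(2)[OF assms] by (simp add: exotic_forest_def)
  then show ?thesis
    by (simp add: F_exotic_def Let_def exotic_diff_def elem_diff_eq_black_diff constant_on_blocks_def)
qed

text \<open>Pulling index maps back along \<open>p\<close> is a bijection that preserves constancy
  on lianas and the black part; the restrictions keep the maps extensional.\<close>

lemma exotic_diff_isomorphism:
  assumes "exotic_isomorphism p G H" "exotic_forest G"
  shows "exotic_diff h f \<phi> x H = exotic_diff h f \<phi> x G"
proof -
  have p: "grafted_isomorphism p G H" and lH: "lianas H = (\<lambda>l. p ` l) ` lianas G"
    using assms(1) by (auto simp: exotic_isomorphism_def)
  have G: "grafted_forest G" using assms(2) by (simp add: exotic_forest_def)
  note D = grafted_isomorphismD[OF p] grafted_forestD[OF G]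
  let ?q = "inv_into (verts G) p"
  have lG: "l \<subseteq> verts G" if "l \<in> lianas G" for l
    using liana_subset_verts[OF assms(2) that] .
  have const: "constant_on_blocks j (lianas G) \<longleftrightarrow> constant_on_blocks i (lianas H)"
    if "\<And>v. v \<in> verts G \<Longrightarrow> j v = i (p v)" for i j :: "nat \<Rightarrow> 'a"
  proof -
    have "constant_on_blocks i (lianas H) \<longleftrightarrow> (\<forall>l\<in>lianas G. \<forall>u\<in>l. \<forall>v\<in>l. i (p u) = i (p v))"
      by (simp add: constant_on_blocks_def lH)
    also have "\<dots> \<longleftrightarrow> constant_on_blocks j (lianas G)"
      unfolding constant_on_blocks_def
      by (intro ball_cong refl) (use lG that in \<open>metis subsetD\<close>)
    finally show ?thesis by simp
  qed
  have card: "card (grafts H) = card (grafts G)"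
    unfolding D(5) by (intro card_image inj_on_subset[OF D(2)] D(8))
  show ?thesis
    unfolding exotic_diff_def card
  proof (rule sum.reindex_bij_witness[where
        j = "\<lambda>i. restrict (i \<circ> p) (verts G)" and i = "\<lambda>i. restrict (i \<circ> ?q) (verts H)"], goal_cases)
    case (1 i)
    then show ?case using D(3) by (auto simp: PiE_def extensional_def fun_eq_iff f_inv_into_f inv_into_into)
  next
    case (2 i)
    then show ?case
      using const[of "restrict (i \<circ> p) (verts G)" i] by simp
  next
    case (3 i)
    then show ?case using D(2,3) by (auto simp: PiE_def extensional_def fun_eq_iff)
  next
    case (4 i)
    then show ?case
      using const[of i "restrict (i \<circ> ?q) (verts H)"] D(2,3) by simp
  next
    case (5 i)
    then show ?case
      using black_diff_cong[OF G, of "restrict (i \<circ> p) (verts G)" "i \<circ> p" h f \<phi> x]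
      by (simp add: black_diff_isomorphism[OF p G])
  qed
qed

lemma F_grafted_eq:
  assumes "\<pi> \<in> AFg"
  shows "F_grafted h f \<xi> \<pi> \<phi> x = (\<Sum>i\<in>verts (rep \<pi>) \<rightarrow>\<^sub>E UNIV.
    black_diff h f \<phi> x (rep \<pi>) i * sqrt (2 * h) ^ card (grafts (rep \<pi>)) * (\<Prod>v\<in>grafts (rep \<pi>). \<xi> $ i v))"
proof -
  have "grafted_forest (rep \<pi>)" using rep_AFg(2)[OF assms] by simp
  then show ?thesis
    by (simp add: F_grafted_def Let_def elem_diff_eq_black_diff prod.distrib mult.assoc)
qed

text \<open>By linearity Isserlis' theorem applies to each index map. Writing its count as a sum
  over matchings and exchanging the sums leaves, for each matching, an exotic operator. With an odd
  number of grafted vertices there is no matching and the expectation is zero.\<close>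

lemma
  assumes "prob_space M" "standard_gaussian M \<xi>" "\<pi> \<in> AFg"
  shows integrable_F_grafted: "integrable M (\<lambda>\<omega>. F_grafted h f (\<xi> \<omega>) \<pi> \<phi> x)"
    and expectation_F_grafted: "(\<integral>\<omega>. F_grafted h f (\<xi> \<omega>) \<pi> \<phi> x \<partial>M) =
      (\<Sum>P\<in>perfect_matchings (grafts (rep \<pi>)). exotic_diff h f \<phi> x (pairing (rep \<pi>) P))"
proof -
  let ?G = "rep \<pi>"
  have G: "grafted_forest ?G" using rep_AFg(2)[OF assms(3)] by simp
  note D = grafted_forestD[OF G]
  let ?I = "verts ?G \<rightarrow>\<^sub>E (UNIV :: 'b set)"
  let ?c = "\<lambda>i. black_diff h f \<phi> x ?G i * sqrt (2 * h) ^ card (grafts ?G)"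
  have fin: "finite ?I" using D(1) by (intro finite_PiE) auto
  note int = integrable_prod_gaussian[OF assms(1,2) D(4)]
  show "integrable M (\<lambda>\<omega>. F_grafted h f (\<xi> \<omega>) \<pi> \<phi> x)"
    unfolding F_grafted_eq[OF assms(3)] using int by (intro Bochner_Integration.integrable_sum integrable_mult_right)
  have "(\<integral>\<omega>. F_grafted h f (\<xi> \<omega>) \<pi> \<phi> x \<partial>M) =
      (\<Sum>i\<in>?I. ?c i * real (card {P \<in> perfect_matchings (grafts ?G). constant_on_blocks i P}))"
    unfolding F_grafted_eq[OF assms(3)]
    using int isserlis[OF assms(1,2) D(4)] by (subst Bochner_Integration.integral_sum) simp_all
  also have "\<dots> = (\<Sum>i\<in>?I. \<Sum>P | P \<in> perfect_matchings (grafts ?G) \<and> constant_on_blocks i P. ?c i)"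
    by (simp add: mult.commute)
  also have "\<dots> = (\<Sum>P\<in>perfect_matchings (grafts ?G). \<Sum>i | i \<in> ?I \<and> constant_on_blocks i P. ?c i)"
    using fin finite_perfect_matchings[OF D(4)] by (rule sum.swap_restrict)
  also have "\<dots> = (\<Sum>P\<in>perfect_matchings (grafts ?G). exotic_diff h f \<phi> x (pairing ?G P))"
    by (simp add: exotic_diff_def black_diff_def)
  finally show "(\<integral>\<omega>. F_grafted h f (\<xi> \<omega>) \<pi> \<phi> x \<partial>M) =
      (\<Sum>P\<in>perfect_matchings (grafts ?G). exotic_diff h f \<phi> x (pairing ?G P))" .
qed

text \<open>A forest of half-order \<open>n\<close> has at most \<open>n\<close> vertices, so it can
  be relabelled inside \<open>{..<n}\<close>, where only finitely many graphs exist. Homogeneous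
  components are therefore genuine finite sums.\<close>

lemma finite_AFg_half_order: "finite {\<pi> \<in> AFg. half_order \<pi> = n}"
proof -
  define \<G> :: "gforest set" where "\<G> = (\<lambda>(V, E, A). \<lparr>verts = V, edges = E, grafts = A\<rparr>) `
    (Pow {..<n} \<times> Pow ({..<n} \<times> {..<n}) \<times> Pow {..<n})"
  have "\<pi> \<in> (\<lambda>G. grafted_iso `` {G}) ` \<G>" if \<pi>: "\<pi> \<in> AFg" "half_order \<pi> = n" for \<pi>
  proof -
    define G where "G = rep \<pi>"
    have G: "grafted_forest G" "grafted_iso `` {G} = \<pi>" using rep_AFg[OF \<pi>(1)] by (auto simp: G_def)
    note D = grafted_forestD[OF G(1)]
    have "verts G = black G \<union> grafts G" using D(3) by (auto simp: black_def)
    then have "card (verts G) \<le> card (black G) + card (grafts G)" by (simp add: card_Un_le)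
    also have "\<dots> \<le> n" using \<pi>(2) by (simp add: half_order_def G_def)
    finally have le: "card (verts G) \<le> n" .
    obtain p where p: "bij_betw p (verts G) {..<card (verts G)}"
      using finite_same_card_bij[OF D(1), of "{..<card (verts G)}"] by auto
    define H where "H = \<lparr>verts = p ` verts G, edges = map_prod p p ` edges G, grafts = p ` grafts G\<rparr>"
    have iso: "grafted_isomorphism p G H"
      using p by (simp add: grafted_isomorphism_def H_def bij_betw_def)
    then have "(G, H) \<in> grafted_iso"
      using G(1) grafted_isomorphism_grafted_forest[OF iso] by (auto simp: grafted_iso_def)
    then have "\<pi> = grafted_iso `` {H}"
      using equiv_class_eq[OF equiv_grafted_iso] G(2) by metis
    moreover have "p v < n" if "v \<in> verts G" for v
      using bij_betwE[OF p] that le by force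
    then have "H \<in> \<G>"
      using D(2,3) unfolding \<G>_def H_def
      by (intro image_eqI[where x = "(p ` verts G, map_prod p p ` edges G, p ` grafts G)"]) auto
    ultimately show ?thesis by blast
  qed
  then have "{\<pi> \<in> AFg. half_order \<pi> = n} \<subseteq> (\<lambda>G. grafted_iso `` {G}) ` \<G>" by blast
  moreover have "finite \<G>" by (simp add: \<G>_def)
  ultimately show ?thesis by (meson finite_imageI finite_subset)
qed

section \<open>Exotic forests above a grafted forest, and regrouping of the series\<close>

lemma exotic_class_pairing:
  assumes "\<pi> \<in> AFg" "P \<in> perfect_matchings (grafts (rep \<pi>))"
  shows "exotic_iso `` {pairing (rep \<pi>) P} \<in> EF" "\<Phi> (exotic_iso `` {pairing (rep \<pi>) P}) = \<pi>"
proof -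
  have E: "exotic_forest (pairing (rep \<pi>) P)"
    using assms rep_AFg(2)[OF assms(1)] by (simp add: exotic_forest_pairing)
  then show "exotic_iso `` {pairing (rep \<pi>) P} \<in> EF" by (simp add: EF_def quotientI)
  show "\<Phi> (exotic_iso `` {pairing (rep \<pi>) P}) = \<pi>"
    using forget_class[OF E] rep_AFg(3)[OF assms(1)] by simp
qed

lemma pairing_in_class_iff:
  assumes "\<pi> \<in> AFg" "P \<in> perfect_matchings (grafts (rep \<pi>))" "\<rho> \<in> EF"
  shows "exotic_iso `` {pairing (rep \<pi>) P} = \<rho> \<longleftrightarrow> pairing (rep \<pi>) P \<in> \<rho>"
proof -
  have E: "exotic_forest (pairing (rep \<pi>) P)"
    using assms rep_AFg(2)[OF assms(1)] by (simp add: exotic_forest_pairing)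
  show ?thesis
    using equiv_class_self[OF equiv_exotic_iso, of "pairing (rep \<pi>) P"] E rep_EF(3)[OF assms(3)]
      equiv_class_eq[OF equiv_exotic_iso] by (metis Image_singleton_iff mem_Collect_eq)
qed

theorem corollary4p5:
  fixes M :: "'w measure" and \<xi> :: "'w \<Rightarrow> real^'d::finite"
    and f :: "real^'d \<Rightarrow> real^'d" and \<phi> :: "real^'d \<Rightarrow> real" and x :: "real^'d"
    and h :: real and a :: "gforest set \<Rightarrow> real"
  assumes "prob_space M" and "standard_gaussian M \<xi>"
    and "smooth_field f" and "smooth \<phi>" and "h > 0"
  shows "(\<forall>\<pi>\<in>AFg. integrable M (\<lambda>\<omega>. F_grafted h f (\<xi> \<omega>) \<pi> \<phi> x)) \<and>
    formal_expectation M (\<lambda>\<omega>. S_series h f (\<xi> \<omega>) a \<phi> x) = ES_series h f (a \<circ> \<Phi>) \<phi> x"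
proof (intro conjI ballI ext)
  note int = integrable_F_grafted[OF assms(1,2)] and E = expectation_F_grafted[OF assms(1,2)]
  show "integrable M (\<lambda>\<omega>. F_grafted h f (\<xi> \<omega>) \<pi> \<phi> x)" if "\<pi> \<in> AFg" for \<pi>
    using that by (rule int)
  fix n
  define A where "A = {\<pi> \<in> AFg. half_order \<pi> = n}"
  define B where "B = {\<rho> \<in> EF. half_order \<rho> = n}"
  \<comment> \<open>\<open>T\<close> indexes the expanded expectation by a grafted forest with a
    pairing of its representative; \<open>c\<close> names the exotic forest so obtained, and
    \<open>t\<close> is the corresponding term.\<close>
  define T where "T = (SIGMA \<pi>:A. perfect_matchings (grafts (rep \<pi>)))"
  define c where "c = (\<lambda>(\<pi>, P). exotic_iso `` {pairing (rep \<pi>) P})"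
  define t where "t = (\<lambda>(\<pi>, P). a \<pi> / real (sigma_g \<pi>) * exotic_diff h f \<phi> x (pairing (rep \<pi>) P))"
  define S where "S \<rho> = {P \<in> perfect_matchings (grafts (rep (\<Phi> \<rho>))). pairing (rep (\<Phi> \<rho>)) P \<in> \<rho>}" for \<rho>
  have fin_grafts: "finite (grafts (rep \<pi>))" if "\<pi> \<in> AFg" for \<pi>
    using rep_AFg(2)[OF that] by (simp add: grafted_forestD)
  have finA: "finite A" unfolding A_def by (rule finite_AFg_half_order)
  have finT: "finite T"
    unfolding T_def using finA fin_grafts by (intro finite_SigmaI finite_perfect_matchings) (auto simp: A_def)
  have cT: "c ` T \<subseteq> B"
    using forget_EF(2) exotic_class_pairing by (fastforce simp: T_def A_def B_def c_def)
  \<comment> \<open>Forgetting the pairing recovers the first component, so a fibre of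
    \<open>c\<close> lies over the single grafted forest \<Phi> \<rho>.\<close>
  have fibre: "{y \<in> T. c y = \<rho>} = Pair (\<Phi> \<rho>) ` S \<rho>" if \<rho>: "\<rho> \<in> B" for \<rho>
  proof -
    have \<rho>': "\<rho> \<in> EF" "\<Phi> \<rho> \<in> A" using \<rho> forget_EF by (auto simp: A_def B_def)
    have unique: "\<pi> = \<Phi> \<rho>" if "(\<pi>, P) \<in> T" "c (\<pi>, P) = \<rho>" for \<pi> P
      using that exotic_class_pairing(2) by (auto simp: T_def A_def c_def)
    have iff: "(\<Phi> \<rho>, P) \<in> T \<and> c (\<Phi> \<rho>, P) = \<rho> \<longleftrightarrow> P \<in> S \<rho>" for P
      using \<rho>' pairing_in_class_iff[of "\<Phi> \<rho>" P \<rho>] by (auto simp: T_def A_def c_def S_def)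
    show ?thesis
    proof (intro set_eqI iffI)
      fix y assume y: "y \<in> {y \<in> T. c y = \<rho>}"
      obtain \<pi> P where [simp]: "y = (\<pi>, P)" by (cases y)
      have \<pi>: "\<pi> = \<Phi> \<rho>" using y by (intro unique) auto
      have "P \<in> S \<rho>" using y iff[of P] by (simp add: \<pi>)
      then show "y \<in> Pair (\<Phi> \<rho>) ` S \<rho>" by (simp add: \<pi>)
    next
      fix y assume "y \<in> Pair (\<Phi> \<rho>) ` S \<rho>"
      then obtain P where "y = (\<Phi> \<rho>, P)" "P \<in> S \<rho>" by blast
      then show "y \<in> {y \<in> T. c y = \<rho>}" using iff[of P] by simp
    qed
  qed
  \<comment> \<open>All pairings in a fibre give the same operator, so the fibre contributes
    \<open>card (S \<rho>) / sigma_g (\<Phi> \<rho>)\<close>, which orbit counting identifies with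
    \<open>1 / sigma_e \<rho>\<close>.\<close>
  have group: "(\<Sum>y\<in>{y \<in> T. c y = \<rho>}. t y) = a (\<Phi> \<rho>) / real (sigma_e \<rho>) * F_exotic h f \<rho> \<phi> x"
    if \<rho>: "\<rho> \<in> B" for \<rho>
  proof -
    have EF: "\<rho> \<in> EF" using \<rho> by (simp add: B_def)
    have "exotic_diff h f \<phi> x (pairing (rep (\<Phi> \<rho>)) P) = F_exotic h f \<rho> \<phi> x"
      if "P \<in> S \<rho>" for P
    proof -
      have "(rep \<rho>, pairing (rep (\<Phi> \<rho>)) P) \<in> exotic_iso"
        using that rep_EF(3)[OF EF] by (auto simp: S_def)
      then obtain p where "exotic_isomorphism p (rep \<rho>) (pairing (rep (\<Phi> \<rho>)) P)" "exotic_forest (rep \<rho>)"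
        by (auto simp: exotic_iso_def)
      then show ?thesis
        by (simp add: exotic_diff_isomorphism F_exotic_eq[OF EF])
    qed
    then have "(\<Sum>y\<in>{y \<in> T. c y = \<rho>}. t y) =
        (\<Sum>P\<in>S \<rho>. a (\<Phi> \<rho>) / real (sigma_g (\<Phi> \<rho>)) * F_exotic h f \<rho> \<phi> x)"
      unfolding fibre[OF \<rho>] by (subst sum.reindex) (auto simp: inj_on_def t_def intro!: sum.cong)
    also have "\<dots> = a (\<Phi> \<rho>) / real (sigma_e \<rho>) * F_exotic h f \<rho> \<phi> x"
      using sigma_g_forget[OF EF S_def] by (simp add: divide_simps)
    finally show ?thesis .
  qed
  \<comment> \<open>Every exotic forest of this half-order arises from some pairing, so
    \<open>B\<close> is covered by the finite image of \<open>c\<close>.\<close>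
  have finB: "finite B"
  proof -
    have "\<rho> \<in> c ` T" if \<rho>: "\<rho> \<in> B" for \<rho>
    proof -
      have EF: "\<rho> \<in> EF" using \<rho> by (simp add: B_def)
      have "S \<rho> \<noteq> {}" using sigma_g_forget[OF EF S_def] by (metis card.empty mult_0 less_irrefl)
      then show ?thesis using fibre[OF \<rho>] by blast
    qed
    then show ?thesis using finT by (meson finite_imageI finite_subset subsetI)
  qed
  have "formal_expectation M (\<lambda>\<omega>. S_series h f (\<xi> \<omega>) a \<phi> x) n =
      (\<Sum>\<pi>\<in>A. a \<pi> / real (sigma_g \<pi>) * (\<integral>\<omega>. F_grafted h f (\<xi> \<omega>) \<pi> \<phi> x \<partial>M))"
    unfolding formal_expectation_def S_series_def A_def[symmetric]
    by (subst Bochner_Integration.integral_sum) (auto simp: A_def intro!: int)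
  also have "\<dots> = (\<Sum>\<pi>\<in>A. \<Sum>P\<in>perfect_matchings (grafts (rep \<pi>)). t (\<pi>, P))"
    by (intro sum.cong refl) (simp add: A_def E t_def sum_distrib_left)
  also have "\<dots> = (\<Sum>y\<in>T. t y)"
    unfolding T_def using finA fin_grafts
    by (subst sum.Sigma) (auto simp: A_def finite_perfect_matchings)
  also have "\<dots> = (\<Sum>\<rho>\<in>B. \<Sum>y\<in>{y \<in> T. c y = \<rho>}. t y)"
    using finT finB cT by (rule sum.group[symmetric])
  also have "\<dots> = ES_series h f (a \<circ> \<Phi>) \<phi> x n"
    unfolding ES_series_def B_def[symmetric] by (intro sum.cong refl) (simp add: group)
  finally show "formal_expectation M (\<lambda>\<omega>. S_series h f (\<xi> \<omega>) a \<phi> x) n = ES_series h f (a \<circ> \<Phi>) \<phi> x n" .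
qed

end
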